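(* Let $\mathcal G$ be a parity game with weights containing $d$ odd colors, let $b\in\mathbb N$, and let $v^*$ be a vertex of $\mathcal G$. If Player $0$ has a strategy $\sigma$ in $\mathcal G$ with $\mathrm{Cost}_{v^*}(\sigma)=b$, then he also has a finite-state strategy $\sigma'$ with $\mathrm{Cost}_{v^*}(\sigma')\le b$ and $|\sigma'|=(2b^2+3b+2)^d$.
   Context: $\mathbb N=\{0,1,2,\dots\}$, $\mathbb N_\infty=\mathbb N\cup\{\infty\}$. An arena $\mathcal A=(V,V_0,V_1,E)$ is a finite directed graph $(V,E)$ in which every vertex has a successor, together with a partition $V=V_0\uplus V_1$ into the vertices of Player $0$ and Player $1$. A play is an infinite path. A strategy for Player $i$ is a map $\sigma:V^*V_i\to V$ with $(v,\sigma(uv))\in E$; a play $v_0v_1\cdots$ is consistent with $\sigma$ if $v_{j+1}=\sigma(v_0\cdots v_j)$ whenever $v_j\in V_i$. A memory structure $(M,\mathrm{init},\mathrm{upd})$ consists of a finite set $M$, $\mathrm{init}:V\to M$ and $\mathrm{upd}:M\times E\to M$; put $\mathrm{upd}^+(v)=\mathrm{init}(v)$ and $\mathrm{upd}^+(uvv')=\mathrm{upd}(\mathrm{upd}^+(uv),(v,v'))$. With a next-move function $\mathrm{Nxt}:V_i\times M\to V$ with $(v,\mathrm{Nxt}(v,m))\in E$ it implements the strategy $\sigma(v_0\cdots v_j)=\mathrm{Nxt}(v_j,\mathrm{upd}^+(v_0\cdots v_j))$. A strategy is finite-state if it is implemented in this way; $|\sigma|$ is the size $|M|$ of a memory structure implementing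 it. A weighting $w:E\to\mathbb Z$ is extended to finite paths by summing the weights of traversed edges (a single vertex has weight $0$). The amplitude of a finite or infinite path $\pi=v_0v_1\cdots$ is $\mathrm{Ampl}(\pi)=\sup_{j<|\pi|}|w(v_0\cdots v_j)|\in\mathbb N_\infty$. For a coloring $\Omega:V\to\mathbb N$ let $\mathrm{Ans}(c)=\{c'\in\mathbb N: c'\ge c,\ c'\text{ even}\}$. For a play $\rho=v_0v_1\cdots$ and $j\in\mathbb N$, $\mathrm{Cor}(\rho,j)=\min\{\mathrm{Ampl}(v_j\cdots v_{j'}) : j'\ge j,\ \Omega(v_{j'})\in\mathrm{Ans}(\Omega(v_j))\}$ with $\min\emptyset=\infty$. A parity game with weights is a game $(\mathcal A,\mathrm{WeightParity}(\Omega,w))$ in which Player $0$ wins exactly the plays in $\mathrm{WeightParity}(\Omega,w)=\{\rho\in V^\omega:\limsup_{j\to\infty}\mathrm{Cor}(\rho,j)\in\mathbb N\}$. The number of odd colors is the number of odd elements of $\Omega(V)$. For a strategy $\sigma$ of Player $0$ and a vertex $v$, $\mathrm{Cost}_v(\sigma)=\sup_\rho\limsup_{j\to\infty}\mathrm{Cor}(\rho,j)$, where $\rho$ ranges over all plays that start in $v$ and are consistent with $\sigma$. *)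

theory Defs
  imports
    "Graph_Theory.Pair_Digraph"
    "Graph_Theory.Vertex_Walk"
    "HOL-Library.Extended_Nat"
    "HOL-Library.Liminf_Limsup"
begin

section \<open>Arenas, plays and strategies\<close>

locale arena = pair_fin_digraph G for G :: "'v pair_pre_digraph" +
  fixes V0 V1 :: "'v set"
  assumes players_cover: "V0 \<union> V1 = pverts G"
    and players_disjoint: "V0 \<inter> V1 = {}"
    and successor_ex: "v \<in> pverts G \<Longrightarrow> \<exists>v'. (v, v') \<in> parcs G"

definition plays :: "'v pair_pre_digraph \<Rightarrow> (nat \<Rightarrow> 'v) set" where
  "plays G = {\<rho>. \<forall>j. (\<rho> j, \<rho> (Suc j)) \<in> parcs G}"

text \<open>
  The infix \<open>\<rho> i \<dots> \<rho> j\<close>, both ends included.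
\<close>

definition segment :: "(nat \<Rightarrow> 'v) \<Rightarrow> nat \<Rightarrow> nat \<Rightarrow> 'v list" where
  "segment \<rho> i j = map \<rho> [i..<Suc j]"

text \<open>
  In the following, \<open>U\<close> is the set of vertices of the player under consideration.
\<close>

definition strategy :: "'v pair_pre_digraph \<Rightarrow> 'v set \<Rightarrow> ('v list \<Rightarrow> 'v) \<Rightarrow> bool" where
  "strategy G U \<sigma> \<longleftrightarrow>
     (\<forall>u v. set u \<subseteq> pverts G \<longrightarrow> v \<in> U \<longrightarrow> (v, \<sigma> (u @ [v])) \<in> parcs G)"

definition consistent :: "'v set \<Rightarrow> ('v list \<Rightarrow> 'v) \<Rightarrow> (nat \<Rightarrow> 'v) \<Rightarrow> bool" where
  "consistent U \<sigma> \<rho> \<longleftrightarrow> (\<forall>j. \<rho> j \<in> U \<longrightarrow> \<rho> (Suc j) = \<sigma> (segment \<rho> 0 j))"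

section \<open>Finite-state strategies\<close>

definition memory_structure ::
  "'v pair_pre_digraph \<Rightarrow> 'm set \<Rightarrow> ('v \<Rightarrow> 'm) \<Rightarrow> ('m \<Rightarrow> 'v \<times> 'v \<Rightarrow> 'm) \<Rightarrow> bool" where
  "memory_structure G M init upd \<longleftrightarrow>
     finite M \<and> (\<forall>v\<in>pverts G. init v \<in> M) \<and> (\<forall>m\<in>M. \<forall>e\<in>parcs G. upd m e \<in> M)"

definition upd_plus ::
  "('v \<Rightarrow> 'm) \<Rightarrow> ('m \<Rightarrow> 'v \<times> 'v \<Rightarrow> 'm) \<Rightarrow> 'v list \<Rightarrow> 'm" where
  "upd_plus init upd p = fold (\<lambda>e m. upd m e) (vwalk_arcs p) (init (hd p))"

lemma upd_plus_single: "upd_plus init upd [v] = init v"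
  by (simp add: upd_plus_def)

lemma upd_plus_snoc:
  "upd_plus init upd (u @ [v, v']) = upd (upd_plus init upd (u @ [v])) (v, v')"
proof -
  have "vwalk_arcs (u @ [v, v']) = vwalk_arcs (u @ [v]) @ [(v, v')]"
    by (induction u rule: vwalk_arcs.induct) auto
  moreover have "hd (u @ [v, v']) = hd (u @ [v])"
    by (cases u) auto
  ultimately show ?thesis
    by (simp add: upd_plus_def)
qed

definition next_move ::
  "'v pair_pre_digraph \<Rightarrow> 'v set \<Rightarrow> 'm set \<Rightarrow> ('v \<Rightarrow> 'm \<Rightarrow> 'v) \<Rightarrow> bool" where
  "next_move G U M nxt \<longleftrightarrow> (\<forall>v\<in>U. \<forall>m\<in>M. (v, nxt v m) \<in> parcs G)"

text \<open>
  The update function is only meaningful on edges, hence \<open>upd_plus\<close> only on finite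
  paths; so an implementation has to agree with the strategy on the finite paths that
  end in \<open>U\<close>, the only histories that occur in plays.
\<close>

definition implements ::
  "'v pair_pre_digraph \<Rightarrow> 'v set \<Rightarrow> ('v \<Rightarrow> 'm) \<Rightarrow> ('m \<Rightarrow> 'v \<times> 'v \<Rightarrow> 'm) \<Rightarrow>
     ('v \<Rightarrow> 'm \<Rightarrow> 'v) \<Rightarrow> ('v list \<Rightarrow> 'v) \<Rightarrow> bool" where
  "implements G U init upd nxt \<sigma> \<longleftrightarrow>
     (\<forall>p. vwalk p (with_proj G) \<longrightarrow> last p \<in> U \<longrightarrow> \<sigma> p = nxt (last p) (upd_plus init upd p))"

text \<open>
  \<open>\<sigma>\<close> is a finite-state strategy implemented with a memory of exactly \<open>n\<close> states.
  As memories are finite, it is no restriction to draw their elements from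
  \<^typ>\<open>nat\<close>.
\<close>

definition finite_state_of_size ::
  "'v pair_pre_digraph \<Rightarrow> 'v set \<Rightarrow> ('v list \<Rightarrow> 'v) \<Rightarrow> nat \<Rightarrow> bool" where
  "finite_state_of_size G U \<sigma> n \<longleftrightarrow>
     strategy G U \<sigma> \<and>
     (\<exists>(M :: nat set) init upd nxt.
        memory_structure G M init upd \<and> next_move G U M nxt \<and>
        implements G U init upd nxt \<sigma> \<and> card M = n)"

section \<open>Parity games with weights\<close>

definition weight :: "('v \<times> 'v \<Rightarrow> int) \<Rightarrow> 'v list \<Rightarrow> int" where
  "weight w p = sum_list (map w (vwalk_arcs p))"

definition amplitude :: "('v \<times> 'v \<Rightarrow> int) \<Rightarrow> 'v list \<Rightarrow> enat" where
  "amplitude w p = (SUP j\<in>{..<length p}. enat (nat \<bar>weight w (take (Suc j) p)\<bar>))"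

definition answers :: "nat \<Rightarrow> nat set" where
  "answers c = {c'. c' \<ge> c \<and> even c'}"

text \<open>
  On \<^typ>\<open>enat\<close>, the infimum of a nonempty set is its minimum, and
  the infimum of the empty set is \<open>\<infinity>\<close>.
\<close>

definition Cor :: "('v \<Rightarrow> nat) \<Rightarrow> ('v \<times> 'v \<Rightarrow> int) \<Rightarrow> (nat \<Rightarrow> 'v) \<Rightarrow> nat \<Rightarrow> enat" where
  "Cor \<Omega> w \<rho> j =
     (INF j'\<in>{j'. j' \<ge> j \<and> \<Omega> (\<rho> j') \<in> answers (\<Omega> (\<rho> j))}. amplitude w (segment \<rho> j j'))"

text \<open>
  A parity game with weights consists of an arena \<open>G\<close>, \<open>V0\<close>, \<open>V1\<close>, a coloring \<open>\<Omega>\<close> and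
  a weighting \<open>w\<close>, neither subject to any condition; Player 0 wins the plays in
  \<open>WeightParity G \<Omega> w\<close>.  The values of \<open>\<Omega>\<close> outside of the vertices and of \<open>w\<close> outside
  of the edges are irrelevant for plays.
\<close>

definition WeightParity ::
  "'v pair_pre_digraph \<Rightarrow> ('v \<Rightarrow> nat) \<Rightarrow> ('v \<times> 'v \<Rightarrow> int) \<Rightarrow> (nat \<Rightarrow> 'v) set" where
  "WeightParity G \<Omega> w = {\<rho>. range \<rho> \<subseteq> pverts G \<and> limsup (Cor \<Omega> w \<rho>) \<noteq> \<infinity>}"

definition num_odd_colors :: "'v pair_pre_digraph \<Rightarrow> ('v \<Rightarrow> nat) \<Rightarrow> nat" where
  "num_odd_colors G \<Omega> = card {c \<in> \<Omega> ` pverts G. odd c}"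

definition Cost ::
  "'v pair_pre_digraph \<Rightarrow> 'v set \<Rightarrow> ('v \<Rightarrow> nat) \<Rightarrow> ('v \<times> 'v \<Rightarrow> int) \<Rightarrow>
     'v \<Rightarrow> ('v list \<Rightarrow> 'v) \<Rightarrow> enat" where
  "Cost G V0 \<Omega> w v \<sigma> =
     (SUP \<rho>\<in>{\<rho> \<in> plays G. \<rho> 0 = v \<and> consistent V0 \<sigma> \<rho>}. limsup (Cor \<Omega> w \<rho>))"

end

(* The memory records, for each odd color, the interval spanned by the weights accumulated since
   the open requests of that color, which has to stay within [-b, b]; there are
   (2b+1)(b+1) + 1 = 2b^2 + 3b + 2 such intervals, counting "no open request".  When some interval
   leaves [-b, b], the memory is reset.  A play has limsup of the costs of response at most b iff
   it has finitely many resets and satisfies the parity condition, which is again a parity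
   condition, on the product of the arena and the memory.  The strategy sigma wins it from v, so a
   positional strategy on the product does as well.  The latter is obtained by moving in every
   product state as sigma does after a history of lexicographically least signature. *)

theory Submission
  imports Defs
begin

section \<open>Total preorders with well-founded strict part\<close>

text \<open>Distinct elements may be equivalent, since different histories may have the same
  signature. Least elements of two-element sets yield totality.\<close>

definition prewellorder :: "('a \<Rightarrow> 'a \<Rightarrow> bool) \<Rightarrow> bool" where
  "prewellorder le \<longleftrightarrow>
     (\<forall>x y z. le x y \<longrightarrow> le y z \<longrightarrow> le x z) \<and> (\<forall>Q. Q \<noteq> {} \<longrightarrow> (\<exists>x\<in>Q. \<forall>y\<in>Q. le x y))"

lemma prewellorder_trans: "prewellorder le \<Longrightarrow> le x y \<Longrightarrow> le y z \<Longrightarrow> le x z"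
  unfolding prewellorder_def by blast

lemma prewellorder_min:
  assumes "prewellorder le" "x \<in> Q"
  obtains y where "y \<in> Q" "\<And>z. z \<in> Q \<Longrightarrow> le y z"
proof -
  have "Q \<noteq> {}" using assms(2) by blast
  then show ?thesis using assms(1) that unfolding prewellorder_def by meson
qed

lemma prewellorder_total: "prewellorder le \<Longrightarrow> le x y \<or> le y x"
  by (rule prewellorder_min[of le x "{x, y}"]) auto

lemma prewellorder_refl: "prewellorder le \<Longrightarrow> le x x"
  using prewellorder_total by fast

text \<open>Comparison of the ordinal ranks of two points in a well-founded relation.\<close>

inductive rank_le :: "('a \<times> 'a) set \<Rightarrow> 'a \<Rightarrow> 'a \<Rightarrow> bool" for R where
  rank_leI: "(\<And>x'. (x', x) \<in> R \<Longrightarrow> \<exists>y'. (y', y) \<in> R \<and> rank_le R x' y') \<Longrightarrow> rank_le R x y"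

lemma rank_leD: "rank_le R x y \<Longrightarrow> (x', x) \<in> R \<Longrightarrow> \<exists>y'. (y', y) \<in> R \<and> rank_le R x' y'"
  by (auto elim: rank_le.cases)

lemma rank_le_refl: "wf R \<Longrightarrow> rank_le R x x"
  by (induction x rule: wf_induct_rule) (auto intro: rank_leI)

lemma rank_le_trans: "rank_le R x y \<Longrightarrow> rank_le R y z \<Longrightarrow> rank_le R x z"
proof (induction arbitrary: z rule: rank_le.induct)
  case (rank_leI x y)
  show ?case
  proof (rule rank_le.rank_leI)
    fix x' assume "(x', x) \<in> R"
    then obtain y' where "(y', y) \<in> R" and y': "\<And>z. rank_le R y' z \<Longrightarrow> rank_le R x' z"
      using rank_leI.IH by blast
    then show "\<exists>z'. (z', z) \<in> R \<and> rank_le R x' z'"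
      using rank_leD[OF rank_leI.prems] by blast
  qed
qed

text \<open>Some \<open>y'\<close> below \<open>y\<close> is dominated by no point below
  \<open>x\<close>. By induction every point below \<open>x\<close> is then dominated by a point
  below \<open>y'\<close>.\<close>

lemma not_rank_le:
  assumes "wf R" "\<not> rank_le R y x"
  shows "\<exists>y'. (y', y) \<in> R \<and> rank_le R x y'"
  using assms
proof (induction x arbitrary: y rule: wf_induct_rule)
  case (less x)
  obtain y' where y': "(y', y) \<in> R" "\<And>x'. (x', x) \<in> R \<Longrightarrow> \<not> rank_le R y' x'"
    using less.prems rank_leI[of y R x] by blast
  have "rank_le R x y'"
    using less.IH y'(2) by (intro rank_leI) blast
  then show ?case using y'(1) by blast
qed

lemma rank_le_prewellorder:
  assumes wf: "wf R"
  shows "prewellorder (rank_le R)"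
  unfolding prewellorder_def
proof (intro conjI allI impI)
  fix x y z assume "rank_le R x y" "rank_le R y z"
  then show "rank_le R x z" by (rule rank_le_trans)
next
  fix Q :: "'a set" assume "Q \<noteq> {}"
  \<comment> \<open>A minimal \<open>y\<close> among the points dominating some \<open>x\<close> in
    \<open>Q\<close> is chosen. If \<open>x\<close> were not least in \<open>Q\<close>, some point
    below \<open>y\<close> would also dominate an element of \<open>Q\<close>.\<close>
  then obtain q where "q \<in> {y. \<exists>x\<in>Q. rank_le R x y}"
    using rank_le_refl[OF wf] by blast
  then obtain y where y: "y \<in> {y. \<exists>x\<in>Q. rank_le R x y}"
    and min: "\<And>y'. (y', y) \<in> R \<Longrightarrow> y' \<notin> {y. \<exists>x\<in>Q. rank_le R x y}"
    by (rule wfE_min[OF wf]) blast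
  obtain x where x: "x \<in> Q" "rank_le R x y" using y by blast
  have "rank_le R x z" if "z \<in> Q" for z
  proof (rule ccontr)
    assume "\<not> rank_le R x z"
    then have "\<not> rank_le R y z" using rank_le_trans x(2) by metis
    then show False using not_rank_le[OF wf] min \<open>z \<in> Q\<close> by blast
  qed
  then show "\<exists>x\<in>Q. \<forall>z\<in>Q. rank_le R x z" using x(1) by blast
qed

text \<open>As \<open>y\<close> lies below \<open>x\<close>, \<open>rank_le R x y\<close> would give
  some \<open>y'\<close> below \<open>y\<close> with \<open>rank_le R y y'\<close>, which the
  induction hypothesis for \<open>y'\<close> excludes.\<close>

lemma rank_le_irrefl:
  assumes "wf R" "(y, x) \<in> R"
  shows "\<not> rank_le R x y"
  using assms
proof (induction y arbitrary: x rule: wf_induct_rule)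
  case (less y)
  show ?case
  proof
    assume "rank_le R x y"
    then show False using less rank_leD by metis
  qed
qed

section \<open>Lexicographic combination of preorders\<close>

primrec lex_le :: "(nat \<Rightarrow> 'a \<Rightarrow> 'a \<Rightarrow> bool) \<Rightarrow> nat \<Rightarrow> 'a \<Rightarrow> 'a \<Rightarrow> bool" where
  "lex_le r 0 x y \<longleftrightarrow> True"
| "lex_le r (Suc n) x y \<longleftrightarrow> lex_le r n x y \<and> (lex_le r n y x \<longrightarrow> r n x y)"

text \<open>Least elements are found one component at a time: among the elements that are least for
  the components before \<open>n\<close>, one that is least for \<open>r n\<close> is taken.\<close>

lemma lex_le_prewellorder:
  assumes r: "\<And>n. prewellorder (r n)"
  shows "prewellorder (lex_le r n)"
proof (induction n)
  case 0
  then show ?case by (auto simp: prewellorder_def)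
next
  case (Suc n)
  show ?case
    unfolding prewellorder_def
  proof (intro conjI allI impI)
    fix x y z assume *: "lex_le r (Suc n) x y" "lex_le r (Suc n) y z"
    then have "lex_le r n x z" by (auto intro: prewellorder_trans[OF Suc])
    moreover have "r n x z" if "lex_le r n z x"
    proof -
      have "lex_le r n y x" "lex_le r n z y"
        using * that by (auto intro: prewellorder_trans[OF Suc])
      then show ?thesis using * by (auto intro: prewellorder_trans[OF r])
    qed
    ultimately show "lex_le r (Suc n) x z" by simp
  next
    fix Q :: "'a set" assume "Q \<noteq> {}"
    then obtain q where "q \<in> Q" by blast
    then obtain x where x: "x \<in> Q" "\<And>z. z \<in> Q \<Longrightarrow> lex_le r n x z"
      using prewellorder_min[OF Suc] by blast
    then obtain y where y: "y \<in> {y \<in> Q. lex_le r n y x}"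
      "\<And>z. z \<in> {y \<in> Q. lex_le r n y x} \<Longrightarrow> r n y z"
      using prewellorder_min[OF r, of x "{y \<in> Q. lex_le r n y x}" n] by blast
    have "lex_le r (Suc n) y z" if z: "z \<in> Q" for z
    proof -
      have "lex_le r n x z" using x(2) z .
      then have "lex_le r n y z" using y(1) by (auto intro: prewellorder_trans[OF Suc])
      moreover have "r n y z" if "lex_le r n z y"
        using that y z by (auto intro: prewellorder_trans[OF Suc])
      ultimately show ?thesis by simp
    qed
    then show "\<exists>x\<in>Q. \<forall>z\<in>Q. lex_le r (Suc n) x z" using y(1) by blast
  qed
qed

lemma lex_le_mono: "m \<le> n \<Longrightarrow> lex_le r n x y \<Longrightarrow> lex_le r m x y"
  by (induction n) (auto simp: le_Suc_eq)

lemma lex_leI: "(\<And>k. k < n \<Longrightarrow> r k x y) \<Longrightarrow> lex_le r n x y"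
  by (induction n) auto

section \<open>Positional strategies for parity conditions\<close>

text \<open>Smaller priorities dominate and even ones are bad.\<close>

definition losing :: "(nat \<Rightarrow> nat) \<Rightarrow> bool" where
  "losing p \<longleftrightarrow> (\<exists>n. even n \<and> (\<forall>i. \<exists>j\<ge>i. p j = n) \<and> (\<exists>i. \<forall>j\<ge>i. p j \<ge> n))"

text \<open>The ranks measure how often \<open>n\<close> can still be visited before a smaller
  priority. For odd \<open>n\<close> the relation is empty and all nodes have equal rank, so only
  bad priorities matter.\<close>

definition visits :: "('h \<Rightarrow> nat \<Rightarrow> 'h \<Rightarrow> bool) \<Rightarrow> nat \<Rightarrow> ('h \<times> 'h) set" where
  "visits step n = {(y, x). even n \<and> (\<exists>z. (x, z) \<in> {(x, z). \<exists>m>n. step x m z}\<^sup>* \<and> step z n y)}"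

text \<open>An infinite descending chain would unroll into an infinite path that takes the even
  priority \<open>n\<close> again and again and never a smaller one. To build it, each move goes
  towards a nearest visit.\<close>

lemma wf_visits:
  assumes winning: "\<And>f p. (\<And>i. step (f i) (p i) (f (Suc i))) \<Longrightarrow> \<not> losing p"
  shows "wf (visits step n)"
proof (rule ccontr)
  define A where "A = {(x, z). \<exists>m>n. step x m z}"
  assume "\<not> wf (visits step n)"
  then obtain Q q where q: "q \<in> Q" and "\<forall>x\<in>Q. \<exists>y. (y, x) \<in> visits step n \<and> y \<in> Q"
    by (auto simp: wf_eq_minimal)
  then have Q: "\<exists>y\<in>Q. (y, x) \<in> visits step n" if "x \<in> Q" for x
    using that by blast
  have "even n" using Q[OF q] by (auto simp: visits_def)
  \<comment> \<open>\<open>k\<close> steps of priority above \<open>n\<close> lead to a step of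
    priority \<open>n\<close> back into \<open>Q\<close>; the least such \<open>k\<close> is the
    distance used as a measure.\<close>
  define reach where "reach x k \<longleftrightarrow> (\<exists>z y. (x, z) \<in> A ^^ k \<and> step z n y \<and> y \<in> Q)" for x k
  define B where "B = {x. \<exists>k. reach x k}"
  have QB: "x \<in> B" if x: "x \<in> Q" for x
  proof -
    obtain y z where "y \<in> Q" "(x, z) \<in> A\<^sup>*" "step z n y"
      using Q[OF x] unfolding visits_def A_def by blast
    then show ?thesis unfolding B_def reach_def by (auto dest!: rtrancl_imp_relpow)
  qed
  have "\<exists>x' m. x' \<in> B \<and> step x m x' \<and> (m = n \<or> (n < m \<and> Least (reach x') < Least (reach x)))"
    if "x \<in> B" for x
  proof -
    have L: "reach x (Least (reach x))"
      using that unfolding B_def by (auto intro: LeastI)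
    show ?thesis
    proof (cases "Least (reach x)")
      case 0
      then show ?thesis using L QB unfolding reach_def by auto
    next
      case (Suc k)
      then obtain z y where "(x, z) \<in> A ^^ Suc k" "step z n y" "y \<in> Q"
        using L unfolding reach_def by auto
      then obtain x' where x': "(x, x') \<in> A" "reach x' k"
        unfolding reach_def by (meson relpow_Suc_D2)
      then show ?thesis
        using Suc Least_le[of "reach x'" k] unfolding A_def B_def by fastforce
    qed
  qed
  then obtain nx pr where nx: "\<And>x. x \<in> B \<Longrightarrow> nx x \<in> B \<and> step x (pr x) (nx x) \<and>
      (pr x = n \<or> (n < pr x \<and> Least (reach (nx x)) < Least (reach x)))"
    by metis
  define f where "f i = (nx ^^ i) q" for i
  have f: "f i \<in> B" for i
    using nx QB[OF q] by (induction i) (auto simp: f_def)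
  have fS: "f (Suc i) = nx (f i)" for i by (simp add: f_def)
  have "\<exists>j\<ge>i. pr (f j) = n" for i
  proof (rule ccontr)
    assume *: "\<not> (\<exists>j\<ge>i. pr (f j) = n)"
    \<comment> \<open>Without further visits of \<open>n\<close> the distance would decrease
      forever.\<close>
    have "Least (reach (f (Suc (i + k)))) < Least (reach (f (i + k)))" for k
      using nx[OF f, of "i + k"] * by (auto simp: fS)
    then have "\<exists>g :: nat \<Rightarrow> nat. \<forall>k. (g (Suc k), g k) \<in> less_than"
      by (intro exI[of _ "\<lambda>k. Least (reach (f (i + k)))"]) auto
    then show False using wf_less_than wf_iff_no_infinite_down_chain by blast
  qed
  moreover have "pr (f i) \<ge> n" for i using nx[OF f, of i] by auto
  ultimately have "losing (\<lambda>i. pr (f i))" unfolding losing_def using \<open>even n\<close> by blast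
  moreover have "step (f i) (pr (f i)) (f (Suc i))" for i using nx f fS by simp
  ultimately show False using winning[of f "\<lambda>i. pr (f i)"] by blast
qed

text \<open>
  The signature of a node lists, for every even \<open>n\<close>, the rank of the node with respect to
  visits of \<open>n\<close> that are not preceded by smaller priorities.  Moving in every state as in a node
  of lexicographically least signature makes signatures decrease along plays.
\<close>

lemma positional:
  fixes step :: "'h \<Rightarrow> nat \<Rightarrow> 'h \<Rightarrow> bool" and proj :: "'h \<Rightarrow> 's"
  assumes winning: "\<And>f p. (\<And>i. step (f i) (p i) (f (Suc i))) \<Longrightarrow> \<not> losing p"
    and bounded: "\<And>x n y. step x n y \<Longrightarrow> n < N"
    and closed: "\<And>x n y. step x n y \<Longrightarrow> y \<in> T"
  obtains rep where "\<And>h. h \<in> T \<Longrightarrow> rep (proj h) \<in> T \<and> proj (rep (proj h)) = proj h"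
    and "\<And>s p. (\<And>i. \<exists>h. step (rep (s i)) (p i) h \<and> proj h = s (Suc i)) \<Longrightarrow> \<not> losing p"
proof -
  define le where "le = lex_le (\<lambda>n. rank_le (visits step n))"
  have wf: "wf (visits step n)" for n using winning by (rule wf_visits)
  have pre: "prewellorder (le n)" for n
    unfolding le_def by (intro lex_le_prewellorder rank_le_prewellorder wf)
  \<comment> \<open>A step of priority above \<open>n\<close> can be put in front of any path to the
    next visit of \<open>n\<close>, so whatever lies below \<open>y\<close> lies below
    \<open>x\<close>.\<close>
  have rank_step: "rank_le (visits step n) y x" if "step x m y" "n < m" for x m y n
  proof (rule rank_leI)
    fix y' assume "(y', y) \<in> visits step n"
    then have "(y', x) \<in> visits step n"
      using that unfolding visits_def by (auto intro: converse_rtrancl_into_rtrancl)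
    then show "\<exists>x'. (x', x) \<in> visits step n \<and> rank_le (visits step n) y' x'"
      using rank_le_refl[OF wf] by blast
  qed
  have rank_step': "rank_le (visits step n) y x" if "step x n y" for x y n
  proof (cases "even n")
    case True
    then have "(y, x) \<in> visits step n" using that unfolding visits_def by blast
    then have "\<not> rank_le (visits step n) x y" by (rule rank_le_irrefl[OF wf])
    then show ?thesis using prewellorder_total[OF rank_le_prewellorder[OF wf]] by blast
  next
    case False
    then show ?thesis unfolding visits_def by (auto intro: rank_leI)
  qed
  \<comment> \<open>\<open>le (Suc m)\<close> compares the components 0 to \<open>m\<close>, none of
    which grows in a step of priority at least \<open>m\<close>.\<close>
  have le_step: "le (Suc m) y x" if "step x n y" "m \<le> n" for x n y m
    unfolding le_def
  proof (rule lex_leI)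
    fix k assume "k < Suc m"
    then show "rank_le (visits step k) y x"
      using that rank_step[of x n y k] rank_step'[of x n y] by (cases "k = n") auto
  qed
  have strict_step: "\<not> le (Suc n) x y" if "step x n y" "even n" for x n y
  proof -
    have "(y, x) \<in> visits step n" using that unfolding visits_def by blast
    then have "\<not> rank_le (visits step n) x y" by (rule rank_le_irrefl[OF wf])
    moreover have "le n y x"
      using le_step[OF that(1) order_refl] unfolding le_def by simp
    ultimately show ?thesis by (simp add: le_def)
  qed
  \<comment> \<open>Comparing \<open>N\<close> components covers all priorities that occur.\<close>
  define rep where
    "rep s = (SOME h. h \<in> T \<and> proj h = s \<and> (\<forall>h'\<in>T. proj h' = s \<longrightarrow> le N h h'))" for s
  have rep: "rep (proj h) \<in> T \<and> proj (rep (proj h)) = proj h \<and> le N (rep (proj h)) h"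
    if h: "h \<in> T" for h
  proof -
    obtain g where "g \<in> {g \<in> T. proj g = proj h}"
      "\<And>g'. g' \<in> {g \<in> T. proj g = proj h} \<Longrightarrow> le N g g'"
      using prewellorder_min[OF pre, of h "{g \<in> T. proj g = proj h}"] h by auto
    then have "\<exists>g. g \<in> T \<and> proj g = proj h \<and> (\<forall>h'\<in>T. proj h' = proj h \<longrightarrow> le N g h')" by blast
    from someI_ex[OF this, folded rep_def] show ?thesis using h by blast
  qed
  have "\<not> losing p" if s: "\<And>i. \<exists>h. step (rep (s i)) (p i) h \<and> proj h = s (Suc i)" for s p
  proof
    assume "losing p"
    then obtain n i0 where n: "even n" "\<And>i. \<exists>j\<ge>i. p j = n" and i0: "\<And>j. j \<ge> i0 \<Longrightarrow> p j \<ge> n"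
      unfolding losing_def by blast
    obtain i where "p i = n" using n(2) by blast
    then have "n < N" using s[of i] bounded by blast
    have below_step: "\<exists>h. step (rep (s i)) (p i) h \<and> le (Suc n) (rep (s (Suc i))) h" for i
    proof -
      obtain h where h: "step (rep (s i)) (p i) h" "proj h = s (Suc i)" using s by blast
      have "le N (rep (s (Suc i))) h" using rep[OF closed[OF h(1)]] h(2) by simp
      then have "le (Suc n) (rep (s (Suc i))) h"
        using \<open>n < N\<close> unfolding le_def by (intro lex_le_mono[of "Suc n" N]) auto
      then show ?thesis using h(1) by blast
    qed
    have dec: "le (Suc n) (rep (s (Suc i))) (rep (s i))" if "i \<ge> i0" for i
      using below_step[of i] le_step i0[OF that] prewellorder_trans[OF pre] by meson
    have strict: "\<not> le (Suc n) (rep (s i)) (rep (s (Suc i)))" if "p i = n" for i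
      using below_step[of i] strict_step n(1) that prewellorder_trans[OF pre] by meson
    \<comment> \<open>The least signature from \<open>i0\<close> on is attained at some
      \<open>i\<close>, but the next visit of \<open>n\<close> after \<open>i\<close> leads to a
      strictly smaller one.\<close>
    obtain y where y: "y \<in> (\<lambda>i. rep (s i)) ` {i0..}"
      "\<And>z. z \<in> (\<lambda>i. rep (s i)) ` {i0..} \<Longrightarrow> le (Suc n) y z"
      using prewellorder_min[OF pre, of "rep (s i0)" "(\<lambda>i. rep (s i)) ` {i0..}"] by auto
    then obtain i where i: "i \<ge> i0" "y = rep (s i)" by auto
    have below: "le (Suc n) (rep (s j)) y" if "j \<ge> i" for j
      using that
    proof (induction j rule: dec_induct)
      case base
      then show ?case using i prewellorder_refl[OF pre] by simp
    next
      case (step j)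
      then show ?case using dec[of j] i prewellorder_trans[OF pre] by (meson order_trans)
    qed
    obtain j where "j \<ge> i" "p j = n" using n(2) by blast
    moreover have "le (Suc n) y (rep (s (Suc j)))" using y(2) i \<open>j \<ge> i\<close> by auto
    ultimately show False using strict below prewellorder_trans[OF pre] by blast
  qed
  then show ?thesis using that rep by blast
qed

section \<open>Amplitudes and costs of response\<close>

definition prefix_weight :: "('v \<times> 'v \<Rightarrow> int) \<Rightarrow> (nat \<Rightarrow> 'v) \<Rightarrow> nat \<Rightarrow> int" where
  "prefix_weight w \<rho> k = (\<Sum>i<k. w (\<rho> i, \<rho> (Suc i)))"

lemma segment_snoc: "i \<le> j \<Longrightarrow> segment \<rho> i j = map \<rho> [i..<j] @ [\<rho> j]"
  by (simp add: segment_def)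

lemma vwalk_arcs_snoc: "vwalk_arcs (u @ [x, y]) = vwalk_arcs (u @ [x]) @ [(x, y)]"
  by (induction u rule: vwalk_arcs.induct) auto

lemma weight_segment:
  assumes "j \<le> k"
  shows "weight w (segment \<rho> j k) = prefix_weight w \<rho> k - prefix_weight w \<rho> j"
  using assms
proof (induction k rule: dec_induct)
  case base
  then show ?case by (simp add: weight_def segment_def)
next
  case (step k)
  then have "segment \<rho> j (Suc k) = map \<rho> [j..<k] @ [\<rho> k, \<rho> (Suc k)]"
    by (simp add: segment_def)
  then show ?case
    using step by (simp add: weight_def vwalk_arcs_snoc segment_snoc prefix_weight_def)
qed

lemma take_segment: "i \<le> j' - j \<Longrightarrow> j \<le> j' \<Longrightarrow> take (Suc i) (segment \<rho> j j') = segment \<rho> j (j + i)"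
  by (auto simp: segment_def take_map simp del: upt_Suc)

lemma amplitude_le_iff:
  assumes "j \<le> j'"
  shows "amplitude w (segment \<rho> j j') \<le> enat b \<longleftrightarrow>
    (\<forall>k\<in>{j..j'}. \<bar>prefix_weight w \<rho> k - prefix_weight w \<rho> j\<bar> \<le> int b)"
proof -
  have len: "length (segment \<rho> j j') = Suc (j' - j)"
    using assms by (simp add: segment_def Suc_diff_le)
  have "amplitude w (segment \<rho> j j') \<le> enat b \<longleftrightarrow>
    (\<forall>i\<in>{..<Suc (j' - j)}. nat \<bar>weight w (take (Suc i) (segment \<rho> j j'))\<bar> \<le> b)"
    by (simp add: amplitude_def SUP_le_iff len)
  also have "\<dots> \<longleftrightarrow>
    (\<forall>i\<in>{..<Suc (j' - j)}. \<bar>prefix_weight w \<rho> (j + i) - prefix_weight w \<rho> j\<bar> \<le> int b)"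
    using assms by (intro ball_cong) (auto simp: take_segment weight_segment)
  also have "\<dots> \<longleftrightarrow> (\<forall>k\<in>{j..j'}. \<bar>prefix_weight w \<rho> k - prefix_weight w \<rho> j\<bar> \<le> int b)"
  proof -
    have "{j..j'} = (\<lambda>i. j + i) ` {..<Suc (j' - j)}"
    proof (intro equalityI subsetI)
      fix k assume "k \<in> {j..j'}"
      then show "k \<in> (\<lambda>i. j + i) ` {..<Suc (j' - j)}" by (intro image_eqI[of _ _ "k - j"]) auto
    qed (use assms in auto)
    then show ?thesis by simp
  qed
  finally show ?thesis .
qed

lemma Cor_le_iff:
  "Cor \<Omega> w \<rho> j \<le> enat b \<longleftrightarrow> (\<exists>j'\<ge>j. \<Omega> (\<rho> j') \<in> answers (\<Omega> (\<rho> j)) \<and>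
     (\<forall>k\<in>{j..j'}. \<bar>prefix_weight w \<rho> k - prefix_weight w \<rho> j\<bar> \<le> int b))"
proof -
  \<comment> \<open>A strict bound on an infimum is the existence of a member below the
    bound.\<close>
  have *: "x \<le> enat b \<longleftrightarrow> x < enat (Suc b)" for x by (cases x) auto
  have "Cor \<Omega> w \<rho> j \<le> enat b \<longleftrightarrow>
    (\<exists>j'\<ge>j. \<Omega> (\<rho> j') \<in> answers (\<Omega> (\<rho> j)) \<and> amplitude w (segment \<rho> j j') \<le> enat b)"
    unfolding Cor_def * by (auto simp: INF_less_iff)
  then show ?thesis by (simp add: amplitude_le_iff cong: conj_cong)
qed

text \<open>On extended naturals the bound \<open>b\<close> is the strict bound
  \<open>Suc b\<close>, and a strict bound on the limit superior holds for almost all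
  members.\<close>

lemma limsup_enat_le_iff:
  "limsup (f :: nat \<Rightarrow> enat) \<le> enat b \<longleftrightarrow> (\<forall>\<^sub>F j in sequentially. f j \<le> enat b)"
proof -
  have *: "x \<le> enat b \<longleftrightarrow> x < enat (Suc b)" for x by (cases x) auto
  show ?thesis
  proof
    assume "limsup f \<le> enat b"
    then show "\<forall>\<^sub>F j in sequentially. f j \<le> enat b"
      using Limsup_lessD[of sequentially f "enat (Suc b)"] by (simp add: *)
  qed (rule Limsup_bounded)
qed

section \<open>The memory structure\<close>

text \<open>States of any type are renamed along a bijection onto an initial segment of the
  naturals.\<close>

lemma finite_state_of_sizeI:
  assumes strat: "strategy G U \<sigma>"
    and mem: "memory_structure G M init upd"
    and nxt: "next_move G U M nxt"
    and impl: "implements G U init upd nxt \<sigma>"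
    and sub: "U \<subseteq> pverts G"
  shows "finite_state_of_size G U \<sigma> (card M)"
proof -
  have fin: "finite M" using mem by (simp add: memory_structure_def)
  obtain h where h: "bij_betw h M {0..<card M}"
    using ex_bij_betw_finite_nat[OF fin] by blast
  define g where "g = the_inv_into M h"
  have gh: "g (h m) = m" if "m \<in> M" for m
    using h that by (simp add: g_def bij_betw_def the_inv_into_f_f)
  define init' where "init' v = h (init v)" for v
  define upd' where "upd' n e = h (upd (g n) e)" for n e
  define nxt' where "nxt' v n = nxt v (g n)" for v n
  have mem': "memory_structure G (h ` M) init' upd'"
    using mem gh by (auto simp: memory_structure_def init'_def upd'_def)
  have nxt'': "next_move G U (h ` M) nxt'"
    using nxt gh by (auto simp: next_move_def nxt'_def)
  \<comment> \<open>Membership in \<open>M\<close> is carried along, since \<open>g\<close> inverts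
    \<open>h\<close> only there.\<close>
  have *: "fold (\<lambda>e m. upd' m e) es (h m) = h (fold (\<lambda>e m. upd m e) es m) \<and>
      fold (\<lambda>e m. upd m e) es m \<in> M" if "set es \<subseteq> parcs G" "m \<in> M" for es m
    using that mem gh by (induction es arbitrary: m) (auto simp: upd'_def memory_structure_def)
  have "upd_plus init' upd' p = h (upd_plus init upd p) \<and> upd_plus init upd p \<in> M"
    if "vwalk p (with_proj G)" for p
  proof -
    have "set (vwalk_arcs p) \<subseteq> parcs G" "hd p \<in> pverts G"
      using that by (auto simp: vwalk_def)
    then show ?thesis
      using *[of "vwalk_arcs p" "init (hd p)"] mem
      by (auto simp: upd_plus_def init'_def memory_structure_def)
  qed
  then have "implements G U init' upd' nxt' \<sigma>"
    using impl gh by (auto simp: implements_def nxt'_def)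
  moreover have "card (h ` M) = card M" using h by (simp add: bij_betw_def card_image)
  ultimately show ?thesis
    using strat mem' nxt'' unfolding finite_state_of_size_def by blast
qed

section \<open>Counting intervals\<close>

lemma finite_intervals: "finite {(l, h). - int b \<le> l \<and> l \<le> h \<and> h \<le> int b}"
  by (rule finite_subset[of _ "{- int b..int b} \<times> {- int b..int b}"]) auto

text \<open>Passing from \<open>b\<close> to \<open>b + 1\<close> adds \<open>2 * b + 3\<close>
  intervals with left end \<open>- (b + 1)\<close> and \<open>2 * b + 2\<close> others with right
  end \<open>b + 1\<close>.\<close>

lemma card_intervals:
  "card {(l, h). - int b \<le> l \<and> l \<le> h \<and> h \<le> int b} = (2 * b + 1) * (b + 1)"
proof (induction b)
  case 0
  have "{(l, h). - int 0 \<le> l \<and> l \<le> h \<and> h \<le> int 0} = {(0, 0)}" by auto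
  then show ?case by simp
next
  case (Suc b)
  let ?I = "\<lambda>b. {(l, h). - int b \<le> l \<and> l \<le> h \<and> h \<le> int b}"
  let ?L = "(\<lambda>h. (- int (Suc b), h)) ` {- int (Suc b)..int (Suc b)}"
  let ?H = "(\<lambda>l. (l, int (Suc b))) ` {- int b..int (Suc b)}"
  have eq: "?I (Suc b) = ?I b \<union> (?L \<union> ?H)"
  proof (intro equalityI subsetI)
    fix x assume "x \<in> ?I (Suc b)"
    then show "x \<in> ?I b \<union> (?L \<union> ?H)" by (cases x) (auto simp: image_iff)
  qed auto
  have "card (?L \<union> ?H) = card ?L + card ?H"
    by (rule card_Un_disjoint) auto
  also have "\<dots> = 4 * b + 5"
    by (simp add: card_image inj_on_def)
  finally have LH: "card (?L \<union> ?H) = 4 * b + 5" .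
  have "card (?I (Suc b)) = card (?I b) + card (?L \<union> ?H)"
    unfolding eq by (rule card_Un_disjoint) (use finite_intervals in auto)
  then show ?case using Suc LH by (simp add: algebra_simps)
qed

locale weighted_arena = arena G V0 V1 for G :: "'v pair_pre_digraph" and V0 V1 +
  fixes \<Omega> :: "'v \<Rightarrow> nat" and w :: "'v \<times> 'v \<Rightarrow> int" and b :: nat
begin

definition odd_colors :: "nat set" where
  "odd_colors = {c \<in> \<Omega> ` pverts G. odd c}"

text \<open>
  A memory state maps each odd color \<open>c\<close> to the least and the greatest weight accumulated
  since an open request of color \<open>c\<close>, or to \<^term>\<open>None\<close> if no such request is open.
\<close>

definition intervals :: "(int \<times> int) option set" where
  "intervals = insert None (Some ` {(l, h). - int b \<le> l \<and> l \<le> h \<and> h \<le> int b})"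

definition memory :: "(nat \<Rightarrow> (int \<times> int) option) set" where
  "memory = (\<Pi>\<^sub>E c\<in>odd_colors. intervals)"

text \<open>A request made at \<open>v\<close> has accumulated weight 0, so the interval is extended
  to contain 0.\<close>

definition visit :: "'v \<Rightarrow> nat \<Rightarrow> (int \<times> int) option \<Rightarrow> (int \<times> int) option" where
  "visit v c I =
     (if \<Omega> v \<in> answers c then None
      else if \<Omega> v = c then (case I of None \<Rightarrow> Some (0, 0) | Some (l, h) \<Rightarrow> Some (min l 0, max h 0))
      else I)"

text \<open>The color of the target is ignored: the amplitude up to an answer includes the weight
  accumulated at the answer itself.\<close>

definition overflow :: "(nat \<Rightarrow> (int \<times> int) option) \<Rightarrow> 'v \<times> 'v \<Rightarrow> bool" where
  "overflow m e \<longleftrightarrow>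
     (\<exists>c\<in>odd_colors. \<exists>l h. m c = Some (l, h) \<and> (l + w e < - int b \<or> h + w e > int b))"

definition init :: "'v \<Rightarrow> nat \<Rightarrow> (int \<times> int) option" where
  "init v = (\<lambda>c\<in>odd_colors. visit v c None)"

definition upd :: "(nat \<Rightarrow> (int \<times> int) option) \<Rightarrow> 'v \<times> 'v \<Rightarrow> nat \<Rightarrow> (int \<times> int) option" where
  "upd m e =
     (if overflow m e then init (snd e)
      else (\<lambda>c\<in>odd_colors. visit (snd e) c (map_option (\<lambda>(l, h). (l + w e, h + w e)) (m c))))"

text \<open>An odd number above all colors, so that exactly the odd colors become even priorities.\<close>

definition top_color :: nat where
  "top_color = Suc (2 * Max (\<Omega> ` pverts G))"

text \<open>Subtraction reverses the order of the colors, as smaller priorities dominate in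
  \<open>losing\<close>. An overflow gets 0, which is even and below the priority of every color of
  a vertex.\<close>

definition priority :: "(nat \<Rightarrow> (int \<times> int) option) \<Rightarrow> 'v \<times> 'v \<Rightarrow> nat" where
  "priority m e = (if overflow m e then 0 else top_color - \<Omega> (snd e))"

lemma color_less_top: "x \<in> pverts G \<Longrightarrow> \<Omega> x < top_color"
proof -
  assume "x \<in> pverts G"
  then have "\<Omega> x \<le> Max (\<Omega> ` pverts G)" by (intro Max_ge) auto
  then show ?thesis by (simp add: top_color_def)
qed

lemma odd_top_color: "odd top_color"
  by (simp add: top_color_def)

lemma finite_odd_colors: "finite odd_colors"
  by (simp add: odd_colors_def)

lemma visit_in_intervals: "I \<in> intervals \<Longrightarrow> visit x c I \<in> intervals"
  by (auto simp: visit_def intervals_def split: option.splits)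

lemma memory_structure_memory: "memory_structure G memory init upd"
proof -
  have init: "init x \<in> memory" for x
    by (auto simp: memory_def init_def intro!: visit_in_intervals) (simp add: intervals_def)
  moreover have "upd m e \<in> memory" if m: "m \<in> memory" for m e
  proof (cases "overflow m e")
    case False
    have "map_option (\<lambda>(l, h). (l + w e, h + w e)) (m c) \<in> intervals" if c: "c \<in> odd_colors" for c
    proof (cases "m c")
      case (Some I)
      obtain l h where I: "I = (l, h)" by (cases I)
      have "m c \<in> intervals" using m c by (auto simp: memory_def)
      then have "l \<le> h" by (auto simp: intervals_def Some I)
      moreover have "- int b \<le> l + w e" "h + w e \<le> int b"
        using False c Some I by (force simp: overflow_def)+
      ultimately show ?thesis by (auto simp: intervals_def Some I)
    qed (simp add: intervals_def)
    then show ?thesis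
      using False by (auto simp: memory_def upd_def intro!: visit_in_intervals)
  qed (simp add: upd_def init)
  moreover have "finite memory"
    unfolding memory_def intervals_def
    by (intro finite_PiE finite_odd_colors) (simp add: finite_intervals)
  ultimately show ?thesis by (simp add: memory_structure_def)
qed

lemma card_memory: "card memory = (2 * b\<^sup>2 + 3 * b + 2) ^ num_odd_colors G \<Omega>"
proof -
  have "card intervals = Suc ((2 * b + 1) * (b + 1))"
    unfolding intervals_def
    by (subst card_insert_disjoint)
      (auto simp: finite_intervals card_image card_intervals simp del: mult_Suc mult_Suc_right)
  also have "\<dots> = 2 * b\<^sup>2 + 3 * b + 2" by (simp add: algebra_simps power2_eq_square)
  finally show ?thesis
    by (simp add: memory_def card_PiE finite_odd_colors num_odd_colors_def odd_colors_def)
qed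

section \<open>The run of the memory along a play\<close>

definition mem :: "(nat \<Rightarrow> 'v) \<Rightarrow> nat \<Rightarrow> nat \<Rightarrow> (int \<times> int) option" where
  "mem \<rho> k = upd_plus init upd (segment \<rho> 0 k)"

lemma mem_0: "mem \<rho> 0 = init (\<rho> 0)"
  by (simp add: mem_def segment_def upd_plus_single)

lemma mem_Suc: "mem \<rho> (Suc k) = upd (mem \<rho> k) (\<rho> k, \<rho> (Suc k))"
  by (simp add: mem_def segment_def upd_plus_snoc)

lemma play_vertex: "\<rho> \<in> plays G \<Longrightarrow> \<rho> k \<in> pverts G"
  unfolding plays_def using in_arcsD1 by fastforce

abbreviation overflows :: "(nat \<Rightarrow> 'v) \<Rightarrow> nat \<Rightarrow> bool" where
  "overflows \<rho> k \<equiv> overflow (mem \<rho> k) (\<rho> k, \<rho> (Suc k))"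

abbreviation priorities :: "(nat \<Rightarrow> 'v) \<Rightarrow> nat \<Rightarrow> nat" where
  "priorities \<rho> k \<equiv> priority (mem \<rho> k) (\<rho> k, \<rho> (Suc k))"

text \<open>The interval and the weight accumulated since \<open>j\<close> are shifted by the same
  edge weights, and new requests only widen the interval.\<close>

lemma mem_covers_requests:
  assumes c: "\<Omega> (\<rho> j) \<in> odd_colors"
    and "j \<le> k"
    and "\<And>i. j \<le> i \<Longrightarrow> i < k \<Longrightarrow> \<not> overflows \<rho> i"
    and "\<And>i. j \<le> i \<Longrightarrow> i \<le> k \<Longrightarrow> \<Omega> (\<rho> i) \<notin> answers (\<Omega> (\<rho> j))"
  shows "\<exists>l h. mem \<rho> k (\<Omega> (\<rho> j)) = Some (l, h) \<and>
    l \<le> prefix_weight w \<rho> k - prefix_weight w \<rho> j \<and> prefix_weight w \<rho> k - prefix_weight w \<rho> j \<le> h"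
  using assms(2-)
proof (induction k rule: dec_induct)
  case base
  have "\<exists>l h. visit (\<rho> j) (\<Omega> (\<rho> j)) I = Some (l, h) \<and> l \<le> 0 \<and> 0 \<le> h" for I
    using base by (auto simp: visit_def split: option.splits)
  moreover have "\<exists>I. mem \<rho> j (\<Omega> (\<rho> j)) = visit (\<rho> j) (\<Omega> (\<rho> j)) I"
    using c by (cases j) (auto simp: mem_0 mem_Suc init_def upd_def)
  ultimately show ?case by auto
next
  case (step k)
  obtain l h where lh: "mem \<rho> k (\<Omega> (\<rho> j)) = Some (l, h)"
    "l \<le> prefix_weight w \<rho> k - prefix_weight w \<rho> j" "prefix_weight w \<rho> k - prefix_weight w \<rho> j \<le> h"
    using step.IH step.prems by fastforce
  have "\<not> overflows \<rho> k" "\<Omega> (\<rho> (Suc k)) \<notin> answers (\<Omega> (\<rho> j))"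
    using step by auto
  then show ?case
    using c lh by (auto simp: mem_Suc upd_def visit_def prefix_weight_def)
qed

text \<open>Each end of an interval is either the shifted old end, with the same request as witness,
  or 0 from a request just made. Thus an overflow can be traced back to an actual request.\<close>

lemma mem_bounds_are_requests:
  assumes "mem \<rho> k c = Some (l, h)" "c \<in> odd_colors"
  shows "\<forall>x\<in>{l, h}. \<exists>j\<le>k. \<Omega> (\<rho> j) = c \<and> prefix_weight w \<rho> k - prefix_weight w \<rho> j = x \<and>
    (\<forall>i. j \<le> i \<and> i < k \<longrightarrow> \<not> overflows \<rho> i) \<and> (\<forall>i. j \<le> i \<and> i \<le> k \<longrightarrow> \<Omega> (\<rho> i) \<notin> answers c)"
  using assms(1)
proof (induction k arbitrary: l h)
  case 0
  then show ?case
    using assms(2) by (auto simp: mem_0 init_def visit_def split: if_splits)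
next
  case (Suc k)
  have new: "\<exists>j\<le>Suc k. \<Omega> (\<rho> j) = c \<and> prefix_weight w \<rho> (Suc k) - prefix_weight w \<rho> j = 0 \<and>
    (\<forall>i. j \<le> i \<and> i < Suc k \<longrightarrow> \<not> overflows \<rho> i) \<and>
    (\<forall>i. j \<le> i \<and> i \<le> Suc k \<longrightarrow> \<Omega> (\<rho> i) \<notin> answers c)"
    if "\<Omega> (\<rho> (Suc k)) = c"
    using that assms(2) by (intro exI[of _ "Suc k"]) (auto simp: odd_colors_def answers_def)
  have unanswered: "\<Omega> (\<rho> (Suc k)) \<notin> answers c"
    using Suc.prems assms(2) by (auto simp: mem_Suc upd_def init_def visit_def split: if_splits)
  show ?case
  proof (cases "overflows \<rho> k")
    case True
    then have "l = 0" "h = 0" "\<Omega> (\<rho> (Suc k)) = c"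
      using Suc.prems assms(2) by (auto simp: mem_Suc upd_def init_def visit_def split: if_splits)
    then show ?thesis using new by simp
  next
    case False
    have old: "\<exists>j\<le>Suc k. \<Omega> (\<rho> j) = c \<and>
      prefix_weight w \<rho> (Suc k) - prefix_weight w \<rho> j = x + w (\<rho> k, \<rho> (Suc k)) \<and>
      (\<forall>i. j \<le> i \<and> i < Suc k \<longrightarrow> \<not> overflows \<rho> i) \<and>
      (\<forall>i. j \<le> i \<and> i \<le> Suc k \<longrightarrow> \<Omega> (\<rho> i) \<notin> answers c)"
      if I: "mem \<rho> k c = Some (l', h')" "x \<in> {l', h'}" for l' h' x
    proof -
      obtain j where "j \<le> k" "\<Omega> (\<rho> j) = c" "prefix_weight w \<rho> k - prefix_weight w \<rho> j = x"
        "\<forall>i. j \<le> i \<and> i < k \<longrightarrow> \<not> overflows \<rho> i"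
        "\<forall>i. j \<le> i \<and> i \<le> k \<longrightarrow> \<Omega> (\<rho> i) \<notin> answers c"
        using Suc.IH[OF I(1)] I(2) by blast
      then show ?thesis
        using False unanswered
        by (intro exI[of _ j]) (auto simp: prefix_weight_def less_Suc_eq le_Suc_eq)
    qed
    show ?thesis
    proof (cases "mem \<rho> k c")
      case None
      then have "l = 0" "h = 0" "\<Omega> (\<rho> (Suc k)) = c"
        using Suc.prems assms(2) False unanswered
        by (auto simp: mem_Suc upd_def visit_def split: if_splits)
      then show ?thesis using new by simp
    next
      case (Some I)
      obtain l' h' where I: "I = (l', h')" by (cases I)
      have bounds: "x \<in> (\<lambda>x. x + w (\<rho> k, \<rho> (Suc k))) ` {l', h'} \<or> x = 0 \<and> \<Omega> (\<rho> (Suc k)) = c"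
        if "x \<in> {l, h}" for x
        using that Suc.prems assms(2) False unanswered Some I
        by (auto simp: mem_Suc upd_def visit_def min_def max_def split: if_splits)
      show ?thesis
      proof
        fix x assume "x \<in> {l, h}"
        then consider x' where "x' \<in> {l', h'}" "x = x' + w (\<rho> k, \<rho> (Suc k))"
          | "x = 0" "\<Omega> (\<rho> (Suc k)) = c"
          using bounds by blast
        then show "\<exists>j\<le>Suc k. \<Omega> (\<rho> j) = c \<and>
          prefix_weight w \<rho> (Suc k) - prefix_weight w \<rho> j = x \<and>
          (\<forall>i. j \<le> i \<and> i < Suc k \<longrightarrow> \<not> overflows \<rho> i) \<and>
          (\<forall>i. j \<le> i \<and> i \<le> Suc k \<longrightarrow> \<Omega> (\<rho> i) \<notin> answers c)"
        proof cases
          case 1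
          then show ?thesis using old[OF Some[unfolded I] 1(1)] by simp
        next
          case 2
          then show ?thesis using new by simp
        qed
      qed
    qed
  qed
qed

text \<open>
  After position \<open>N\<close>, at most one overflow can occur: it resets the memory, so the next one would
  exhibit a request after \<open>N\<close> whose cost exceeds \<open>b\<close>.
\<close>

lemma at_most_one_overflow:
  assumes Cor: "\<And>j. j \<ge> N \<Longrightarrow> Cor \<Omega> w \<rho> j \<le> enat b"
    and k: "N \<le> k" "k < k'" "overflows \<rho> k"
  shows "\<not> overflows \<rho> k'"
proof
  assume "overflows \<rho> k'"
  then obtain c l h where c: "c \<in> odd_colors" and m: "mem \<rho> k' c = Some (l, h)"
    and "l + w (\<rho> k', \<rho> (Suc k')) < - int b \<or> h + w (\<rho> k', \<rho> (Suc k')) > int b"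
    unfolding overflow_def by blast
  then have "\<bar>l + w (\<rho> k', \<rho> (Suc k'))\<bar> > int b \<or> \<bar>h + w (\<rho> k', \<rho> (Suc k'))\<bar> > int b"
    by linarith
  then obtain x where x: "x \<in> {l, h}" "\<bar>x + w (\<rho> k', \<rho> (Suc k'))\<bar> > int b"
    by blast
  obtain j where j: "j \<le> k'" "\<Omega> (\<rho> j) = c" "prefix_weight w \<rho> k' - prefix_weight w \<rho> j = x"
    "\<And>i. j \<le> i \<Longrightarrow> i < k' \<Longrightarrow> \<not> overflows \<rho> i"
    "\<And>i. j \<le> i \<Longrightarrow> i \<le> k' \<Longrightarrow> \<Omega> (\<rho> i) \<notin> answers c"
    using mem_bounds_are_requests[OF m c] x(1) by blast
  \<comment> \<open>The overflow at \<open>k\<close> is not between \<open>j\<close> and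
    \<open>k'\<close>, so the request was made after \<open>k\<close>.\<close>
  have "j \<ge> N" using j(4)[of k] k by (cases "j \<le> k") auto
  then obtain j' where j': "j' \<ge> j" "\<Omega> (\<rho> j') \<in> answers c"
    "\<And>i. i \<in> {j..j'} \<Longrightarrow> \<bar>prefix_weight w \<rho> i - prefix_weight w \<rho> j\<bar> \<le> int b"
    using Cor[of j] j(2) unfolding Cor_le_iff by auto
  \<comment> \<open>The answer comes after the overflowing edge, whose weight therefore enters the
    amplitude.\<close>
  have "Suc k' \<le> j'" using j(5) j'(1,2) by (meson not_less_eq_eq)
  then have "\<bar>prefix_weight w \<rho> (Suc k') - prefix_weight w \<rho> j\<bar> \<le> int b"
    using j'(3) j(1) by auto
  then show False using x(2) j(3) by (auto simp: prefix_weight_def algebra_simps)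
qed

text \<open>Dominating priority 0 would mean infinitely many overflows. A positive even one belongs
  to a recurring odd color, whose answers have larger colors and thus smaller priorities.\<close>

lemma priorities_not_losing:
  assumes play: "\<rho> \<in> plays G" and lim: "limsup (Cor \<Omega> w \<rho>) \<le> enat b"
  shows "\<not> losing (priorities \<rho>)"
proof
  assume "losing (priorities \<rho>)"
  then obtain n i0 where n: "even n" "\<And>i. \<exists>j\<ge>i. priorities \<rho> j = n"
    and i0: "\<And>j. j \<ge> i0 \<Longrightarrow> priorities \<rho> j \<ge> n"
    unfolding losing_def by blast
  obtain N where N: "\<And>j. j \<ge> N \<Longrightarrow> Cor \<Omega> w \<rho> j \<le> enat b"
    using lim unfolding limsup_enat_le_iff eventually_sequentially by blast
  have pos: "top_color - \<Omega> (\<rho> k) > 0" for k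
    using color_less_top[OF play_vertex[OF play]] by simp
  show False
  proof (cases "n = 0")
    case True
    obtain k where k: "k \<ge> N" "priorities \<rho> k = 0" using n(2) True by blast
    obtain k' where k': "k' \<ge> Suc k" "priorities \<rho> k' = 0" using n(2) True by blast
    have "overflows \<rho> k" "overflows \<rho> k'"
      using k(2) k'(2) pos[of "Suc k"] pos[of "Suc k'"]
      by (auto simp: priority_def split: if_splits)
    then show False using at_most_one_overflow[of N \<rho> k k', OF N] k(1) k'(1) by simp
  next
    case False
    obtain j where j: "j \<ge> max N i0" "priorities \<rho> j = n" using n(2) by blast
    have nj: "n = top_color - \<Omega> (\<rho> (Suc j))"
      using j(2) False by (simp add: priority_def split: if_splits)
    then have odd: "odd (\<Omega> (\<rho> (Suc j)))"
      using n(1) odd_top_color pos[of "Suc j"] by simp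
    obtain j' where j': "j' \<ge> Suc j" "\<Omega> (\<rho> j') \<in> answers (\<Omega> (\<rho> (Suc j)))"
      using N[of "Suc j"] j(1) unfolding Cor_le_iff by auto
    then have "\<Omega> (\<rho> (Suc j)) < \<Omega> (\<rho> j')"
      using odd by (auto simp: answers_def le_less)
    \<comment> \<open>The color of the answer at \<open>j'\<close> enters the priority of the edge
      into it, at position \<open>j' - 1\<close>.\<close>
    moreover obtain i where i: "j' = Suc i" using j'(1) by (cases j') auto
    ultimately have "top_color - \<Omega> (\<rho> (Suc i)) < n"
      using nj pos[of "Suc i"] pos[of "Suc j"] by auto
    moreover have "priorities \<rho> i \<ge> n" using i0[of i] i j(1) j'(1) by simp
    ultimately show False using False by (simp add: priority_def split: if_splits)
  qed
qed

text \<open>The least recurring priority is odd, hence not 0: overflows cease, and a recurring even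
  color answers all late requests. Until the answer, the bounds on the intervals bound the
  accumulated weight.\<close>

lemma limsup_Cor_le:
  assumes play: "\<rho> \<in> plays G" and nl: "\<not> losing (priorities \<rho>)"
  shows "limsup (Cor \<Omega> w \<rho>) \<le> enat b"
proof -
  have "\<exists>n. \<exists>\<^sub>\<infinity>j. priorities \<rho> j = n"
  proof -
    have "finite (range (priorities \<rho>))"
      by (rule finite_subset[of _ "{..top_color}"]) (auto simp: priority_def)
    then obtain k where "infinite (priorities \<rho> -` {priorities \<rho> k})"
      using pigeonhole_infinite[of UNIV "priorities \<rho>"] by (auto simp: vimage_def)
    then show ?thesis unfolding INFM_iff_infinite by (auto simp: vimage_def)
  qed
  define n where "n = (LEAST n. \<exists>\<^sub>\<infinity>j. priorities \<rho> j = n)"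
  have n: "\<exists>\<^sub>\<infinity>j. priorities \<rho> j = n"
    unfolding n_def using \<open>\<exists>n. \<exists>\<^sub>\<infinity>j. priorities \<rho> j = n\<close> by (rule LeastI_ex)
  have "\<forall>\<^sub>\<infinity>j. \<forall>m\<in>{..<n}. priorities \<rho> j \<noteq> m"
  proof (intro eventually_ball_finite ballI)
    fix m assume "m \<in> {..<n}"
    then have "\<not> (\<exists>\<^sub>\<infinity>j. priorities \<rho> j = m)"
      unfolding n_def by (intro not_less_Least) simp
    then show "\<forall>\<^sub>\<infinity>j. priorities \<rho> j \<noteq> m" by (simp only: not_frequently)
  qed simp
  then have "\<forall>\<^sub>\<infinity>j. priorities \<rho> j \<ge> n"
  proof (rule eventually_mono)
    fix j assume *: "\<forall>m\<in>{..<n}. priorities \<rho> j \<noteq> m"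
    show "n \<le> priorities \<rho> j"
    proof (rule ccontr)
      assume "\<not> n \<le> priorities \<rho> j"
      then show False using *[rule_format, of "priorities \<rho> j"] by simp
    qed
  qed
  then obtain N where N: "\<And>j. j \<ge> N \<Longrightarrow> priorities \<rho> j \<ge> n"
    unfolding MOST_nat_le by blast
  have inf: "\<exists>j\<ge>i. priorities \<rho> j = n" for i using n unfolding INFM_nat_le by blast
  then have "odd n" using nl N unfolding losing_def by blast
  have no: "\<not> overflows \<rho> j" if "j \<ge> N" for j
  proof
    assume "overflows \<rho> j"
    then have "n = 0" using N[OF that] by (simp add: priority_def)
    then show False using \<open>odd n\<close> by simp
  qed
  have less: "\<Omega> (\<rho> k) < top_color" for k using color_less_top[OF play_vertex[OF play]] .
  have "Cor \<Omega> w \<rho> j \<le> enat b" if j: "j \<ge> Suc N" for j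
  proof (cases "odd (\<Omega> (\<rho> j))")
    case False
    then show ?thesis unfolding Cor_le_iff by (intro exI[of _ j]) (auto simp: answers_def)
  next
    case True
    let ?c = "\<Omega> (\<rho> j)"
    have c: "?c \<in> odd_colors" using True play_vertex[OF play] by (simp add: odd_colors_def)
    obtain i where i: "i \<ge> j" "priorities \<rho> i = n" using inf by blast
    have ni: "n = top_color - \<Omega> (\<rho> (Suc i))" using i j no[of i] by (simp add: priority_def)
    obtain j0 where j0: "j = Suc j0" "j0 \<ge> N" using j by (cases j) auto
    \<comment> \<open>The request at \<open>j\<close> contributes its color to the priority at
      \<open>j - 1\<close>, which explains the threshold \<open>Suc N\<close>.\<close>
    have "n \<le> top_color - ?c" using N[of j0] no[of j0] j0 by (simp add: priority_def)
    then have "\<Omega> (\<rho> (Suc i)) \<in> answers ?c"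
      using ni \<open>odd n\<close> odd_top_color less[of "Suc i"] less[of j] by (auto simp: answers_def)
    then have ex: "\<exists>k. k \<ge> j \<and> \<Omega> (\<rho> k) \<in> answers ?c" using i(1) le_Suc_eq by blast
    \<comment> \<open>Before the first answer the request is open, so the memory still accounts for
      it.\<close>
    define a where "a = (LEAST k. k \<ge> j \<and> \<Omega> (\<rho> k) \<in> answers ?c)"
    have a: "a \<ge> j" "\<Omega> (\<rho> a) \<in> answers ?c"
      using LeastI_ex[OF ex] unfolding a_def by auto
    have before: "\<Omega> (\<rho> k) \<notin> answers ?c" if "j \<le> k" "k < a" for k
      using that not_less_Least unfolding a_def by blast
    have "\<bar>prefix_weight w \<rho> k - prefix_weight w \<rho> j\<bar> \<le> int b" if k: "k \<in> {j..a}" for k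
    proof (cases "k = j")
      case False
      then obtain k0 where k0: "k = Suc k0" "j \<le> k0" "k0 < a" using k by (cases k) auto
      \<comment> \<open>The bound at \<open>k\<close> comes from the edge into \<open>k\<close> not
        overflowing. This also treats \<open>k = a\<close>, where the memory has already dropped the
        request.\<close>
      obtain l h where lh: "mem \<rho> k0 ?c = Some (l, h)"
        "l \<le> prefix_weight w \<rho> k0 - prefix_weight w \<rho> j"
        "prefix_weight w \<rho> k0 - prefix_weight w \<rho> j \<le> h"
        using mem_covers_requests[of \<rho> j k0] c no before j k0 by force
      have "\<not> overflows \<rho> k0" using no k0 j by simp
      then have "- int b \<le> l + w (\<rho> k0, \<rho> (Suc k0))" "h + w (\<rho> k0, \<rho> (Suc k0)) \<le> int b"
        using c lh(1) by (force simp: overflow_def)+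
      then show ?thesis using lh k0(1) by (auto simp: prefix_weight_def)
    qed simp
    then show ?thesis unfolding Cor_le_iff using a by blast
  qed
  then show ?thesis unfolding limsup_enat_le_iff eventually_sequentially by blast
qed

section \<open>The finite-state strategy\<close>

text \<open>These are the nodes of the tree of finite paths from \<open>v\<close> consistent with
  \<open>\<sigma>\<close>; \<open>positional\<close> is applied to this tree.\<close>

inductive_set histories :: "'v \<Rightarrow> ('v list \<Rightarrow> 'v) \<Rightarrow> 'v list set" for v \<sigma> where
  start: "[v] \<in> histories v \<sigma>"
| extend: "p \<in> histories v \<sigma> \<Longrightarrow> (last p, x) \<in> parcs G \<Longrightarrow> (last p \<in> V0 \<Longrightarrow> x = \<sigma> p) \<Longrightarrow>
    p @ [x] \<in> histories v \<sigma>"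

lemma histories_nonempty: "p \<in> histories v \<sigma> \<Longrightarrow> p \<noteq> []"
  by (induction rule: histories.induct) auto

lemma hd_histories: "p \<in> histories v \<sigma> \<Longrightarrow> p ! 0 = v"
  by (induction rule: histories.induct) (auto simp: nth_append dest: histories_nonempty)

lemma set_histories: "p \<in> histories v \<sigma> \<Longrightarrow> v \<in> pverts G \<Longrightarrow> set p \<subseteq> pverts G"
  by (induction rule: histories.induct) (auto dest: in_arcsD2)

lemma histories_nth:
  "p \<in> histories v \<sigma> \<Longrightarrow> Suc j < length p \<Longrightarrow>
     (p ! j, p ! Suc j) \<in> parcs G \<and> (p ! j \<in> V0 \<longrightarrow> p ! Suc j = \<sigma> (take (Suc j) p))"
proof (induction rule: histories.induct)
  case (extend p x)
  show ?case
  proof (cases "Suc j < length p")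
    case True
    then show ?thesis using extend by (simp add: nth_append)
  next
    case False
    then have j: "Suc j = length p" using extend.prems by simp
    then have "p ! j = last p" by (metis diff_Suc_1 last_conv_nth length_0_conv nat.distinct(1))
    then show ?thesis using extend j by (auto simp: nth_append)
  qed
qed simp

definition step :: "'v \<Rightarrow> ('v list \<Rightarrow> 'v) \<Rightarrow> 'v list \<Rightarrow> nat \<Rightarrow> 'v list \<Rightarrow> bool" where
  "step v \<sigma> p n q \<longleftrightarrow> p \<in> histories v \<sigma> \<and> q \<in> histories v \<sigma> \<and>
     (\<exists>x. q = p @ [x] \<and> n = priority (upd_plus init upd p) (last p, x))"

text \<open>The histories on an infinite path are prefixes of one play consistent with
  \<open>\<sigma>\<close>. The path may start at any history, so its priorities form a suffix of
  those of the play, and \<open>losing\<close> depends only on suffixes.\<close>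

lemma history_tree_winning:
  assumes cost: "Cost G V0 \<Omega> w v \<sigma> \<le> enat b"
    and path: "\<And>i. step v \<sigma> (f i) (p i) (f (Suc i))"
  shows "\<not> losing p"
proof
  assume "losing p"
  define L where "L = length (f 0)"
  have hist: "f i \<in> histories v \<sigma>" for i using path step_def by blast
  have len: "length (f i) = L + i" for i
  proof (induction i)
    case (Suc i)
    then show ?case using path[of i] by (auto simp: step_def)
  qed (simp add: L_def)
  have "L > 0" using histories_nonempty[OF hist[of 0]] by (simp add: L_def)
  have nth: "f j ! k = f i ! k" if "i \<le> j" "k < L + i" for i j k
    using that
  proof (induction j rule: dec_induct)
    case (step j)
    then show ?case using path[of j] len by (auto simp: step_def nth_append)
  qed simp
  \<comment> \<open>The diagonal is well defined since \<open>f k\<close> has length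
    \<open>L + k\<close> and \<open>L\<close> is positive.\<close>
  define \<rho> where "\<rho> k = f k ! k" for k
  have nth\<rho>: "f i ! k = \<rho> k" if "k < L + i" for i k
    unfolding \<rho>_def using that \<open>L > 0\<close> nth[of i k k] nth[of k i k] by (cases "i \<le> k") auto
  have take: "take (Suc k) (f i) = segment \<rho> 0 k" if "k < L + i" for i k
    by (rule nth_equalityI) (use that nth\<rho> len in \<open>auto simp: segment_def simp del: upt_Suc\<close>)
  have edges: "(\<rho> k, \<rho> (Suc k)) \<in> parcs G \<and> (\<rho> k \<in> V0 \<longrightarrow> \<rho> (Suc k) = \<sigma> (segment \<rho> 0 k))" for k
    using histories_nth[OF hist[of "Suc k"], of k] len[of "Suc k"] \<open>L > 0\<close>
      nth\<rho>[of k "Suc k"] nth\<rho>[of "Suc k" "Suc k"] take[of k "Suc k"] by simp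
  have play: "\<rho> \<in> plays G" and cons: "consistent V0 \<sigma> \<rho>"
    using edges by (auto simp: plays_def consistent_def)
  have "\<rho> 0 = v" using hd_histories[OF hist] by (simp add: \<rho>_def)
  then have "limsup (Cor \<Omega> w \<rho>) \<le> Cost G V0 \<Omega> w v \<sigma>"
    unfolding Cost_def using play cons by (intro SUP_upper) auto
  then have "\<not> losing (priorities \<rho>)"
    using priorities_not_losing[OF play] cost by simp
  moreover have "losing (priorities \<rho>)"
  proof -
    \<comment> \<open>The last position of \<open>f i\<close> is \<open>i + l\<close>.\<close>
    define l where "l = L - 1"
    have p: "p i = priorities \<rho> (i + l)" for i
    proof -
      obtain x where x: "f (Suc i) = f i @ [x]"
        "p i = priority (upd_plus init upd (f i)) (last (f i), x)"
        using path step_def by blast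
      have "f i = segment \<rho> 0 (i + l)"
        using take[of "i + l" i] len[of i] \<open>L > 0\<close> by (simp add: l_def)
      moreover have "last (f i) = \<rho> (i + l)"
        using \<open>f i = _\<close> by (simp add: segment_def)
      moreover have "x = \<rho> (Suc (i + l))"
        using nth\<rho>[of "L + i" "Suc i"] x(1) len[of i] \<open>L > 0\<close>
        by (simp add: nth_append l_def) (metis Suc_pred add.commute add_Suc_right)
      ultimately show ?thesis using x(2) by (simp add: mem_def)
    qed
    obtain n i0 where n: "even n" "\<And>i. \<exists>j\<ge>i. p j = n" "\<And>j. j \<ge> i0 \<Longrightarrow> p j \<ge> n"
      using \<open>losing p\<close> unfolding losing_def by blast
    have "\<exists>j\<ge>i. priorities \<rho> j = n" for i
      using n(2)[of i] p by (metis trans_le_add1)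
    moreover have "\<forall>j\<ge>i0 + l. priorities \<rho> j \<ge> n"
    proof (intro allI impI)
      fix j assume "i0 + l \<le> j"
      then show "priorities \<rho> j \<ge> n" using n(3)[of "j - l"] p[of "j - l"] by simp
    qed
    ultimately show ?thesis using n(1) unfolding losing_def by blast
  qed
  ultimately show False by blast
qed

lemma finite_state_strategy:
  assumes v: "v \<in> pverts G" and strat: "strategy G V0 \<sigma>"
    and cost: "Cost G V0 \<Omega> w v \<sigma> \<le> enat b"
  obtains \<sigma>' where "finite_state_of_size G V0 \<sigma>' (card memory)" "Cost G V0 \<Omega> w v \<sigma>' \<le> enat b"
proof -
  define state where "state p = (last p, upd_plus init upd p)" for p
  let ?T = "histories v \<sigma>"
  obtain rep where rep: "\<And>p. p \<in> ?T \<Longrightarrow> rep (state p) \<in> ?T \<and> state (rep (state p)) = state p"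
    and rep_winning: "\<And>s p. (\<And>i. \<exists>h. step v \<sigma> (rep (s i)) (p i) h \<and> state h = s (Suc i)) \<Longrightarrow>
      \<not> losing p"
  proof (rule positional[of "step v \<sigma>" "Suc top_color" ?T state])
    show "\<not> losing p" if "\<And>i. step v \<sigma> (f i) (p i) (f (Suc i))" for f p
      using history_tree_winning[OF cost, of f p] that by blast
    show "n < Suc top_color" if "step v \<sigma> p n q" for p n q
      using that by (auto simp: step_def priority_def)
    show "q \<in> ?T" if "step v \<sigma> p n q" for p n q
      using that by (auto simp: step_def)
  qed blast
  \<comment> \<open>In states that no history reaches, an arbitrary successor is taken to make
    \<open>nxt\<close> a next-move function.\<close>
  define nxt where
    "nxt x m = (if (x, m) \<in> state ` ?T then \<sigma> (rep (x, m)) else (SOME y. (x, y) \<in> parcs G))" for x m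
  define \<sigma>' where "\<sigma>' p = nxt (last p) (upd_plus init upd p)" for p
  have V0: "V0 \<subseteq> pverts G" using players_cover by blast
  have nxt: "(x, nxt x m) \<in> parcs G" if x: "x \<in> V0" for x m
  proof (cases "(x, m) \<in> state ` ?T")
    case True
    let ?p = "rep (x, m)"
    have p: "?p \<in> ?T" "state ?p = (x, m)" using True rep by auto
    then have "?p \<noteq> []" "last ?p = x" using histories_nonempty by (auto simp: state_def)
    then obtain u where u: "?p = u @ [x]" by (metis append_butlast_last_id)
    then have "set u \<subseteq> pverts G" using set_histories[OF p(1) v] by simp
    then have "(x, \<sigma> (u @ [x])) \<in> parcs G" using strat x unfolding strategy_def by blast
    then show ?thesis using True u by (simp add: nxt_def)
  next
    case False
    have "\<exists>y. (x, y) \<in> parcs G" using successor_ex x V0 by blast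
    then show ?thesis using False by (auto simp: nxt_def intro: someI_ex)
  qed
  have "finite_state_of_size G V0 \<sigma>' (card memory)"
  proof (rule finite_state_of_sizeI[OF _ memory_structure_memory _ _ V0])
    show "strategy G V0 \<sigma>'" using nxt by (simp add: strategy_def \<sigma>'_def)
    show "next_move G V0 memory nxt" using nxt by (simp add: next_move_def)
    show "implements G V0 init upd nxt \<sigma>'" by (simp add: implements_def \<sigma>'_def)
  qed
  moreover have "limsup (Cor \<Omega> w \<rho>) \<le> enat b"
    if play: "\<rho> \<in> plays G" and \<rho>0: "\<rho> 0 = v" and cons: "consistent V0 \<sigma>' \<rho>" for \<rho>
  proof -
    define s where "s k = (\<rho> k, mem \<rho> k)" for k
    \<comment> \<open>The actual history may differ from the representative of its state. Still,
      appending the next vertex of \<open>\<rho>\<close> to the representative yields a history: at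
      vertices of \<open>V0\<close> both follow \<open>nxt\<close>, elsewhere every edge is
      allowed.\<close>
    have move: "\<exists>h. step v \<sigma> (rep (s k)) (priorities \<rho> k) h \<and> state h = s (Suc k)"
      if k: "s k \<in> state ` ?T" for k
    proof -
      let ?p = "rep (s k)"
      have p: "?p \<in> ?T" "state ?p = s k" using k rep by auto
      have last: "last ?p = \<rho> k" and upd: "upd_plus init upd ?p = mem \<rho> k"
        using p(2) by (auto simp: state_def s_def)
      have edge: "(\<rho> k, \<rho> (Suc k)) \<in> parcs G" using play by (simp add: plays_def)
      have "\<rho> (Suc k) = \<sigma> ?p" if "\<rho> k \<in> V0"
      proof -
        have "\<rho> (Suc k) = nxt (\<rho> k) (mem \<rho> k)"
          using cons that by (simp add: consistent_def \<sigma>'_def mem_def segment_def)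
        then show ?thesis using k by (simp add: nxt_def s_def)
      qed
      then have "?p @ [\<rho> (Suc k)] \<in> ?T"
        using p(1) edge last by (intro histories.extend) auto
      moreover have "upd_plus init upd (?p @ [\<rho> (Suc k)]) = mem \<rho> (Suc k)"
      proof -
        have "?p = butlast ?p @ [\<rho> k]"
          using last histories_nonempty[OF p(1)] by (metis append_butlast_last_id)
        then show ?thesis
          using upd upd_plus_snoc[of init upd "butlast ?p" "\<rho> k" "\<rho> (Suc k)"]
          by (simp add: mem_Suc) (metis append_assoc append_Cons append_Nil)
      qed
      ultimately show ?thesis
        using p(1) last upd
        by (intro exI[of _ "?p @ [\<rho> (Suc k)]"]) (simp add: step_def state_def s_def)
    qed
    have "s k \<in> state ` ?T" for k
    proof (induction k)
      case 0
      have "state [v] = s 0" using \<rho>0 by (simp add: state_def s_def mem_0 upd_plus_single)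
      then show ?case using histories.start by force
    next
      case (Suc k)
      then show ?case using move[OF Suc] by (auto simp: step_def) (metis image_eqI)
    qed
    then have "\<not> losing (priorities \<rho>)" using move by (intro rep_winning[of s]) blast
    then show ?thesis by (rule limsup_Cor_le[OF play])
  qed
  then have "Cost G V0 \<Omega> w v \<sigma>' \<le> enat b" unfolding Cost_def by (intro SUP_least) auto
  ultimately show ?thesis using that by blast
qed

end

theorem lemma9p11:
  fixes G :: "'v pair_pre_digraph" and V0 V1 :: "'v set"
    and \<Omega> :: "'v \<Rightarrow> nat" and w :: "'v \<times> 'v \<Rightarrow> int"
    and d b :: nat and v :: 'v and \<sigma> :: "'v list \<Rightarrow> 'v"
  assumes "arena G V0 V1"
    and "num_odd_colors G \<Omega> = d"
    and "v \<in> pverts G"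
    and "strategy G V0 \<sigma>"
    and "Cost G V0 \<Omega> w v \<sigma> = enat b"
  shows "\<exists>\<sigma>'. finite_state_of_size G V0 \<sigma>' ((2 * b\<^sup>2 + 3 * b + 2) ^ d) \<and>
              Cost G V0 \<Omega> w v \<sigma>' \<le> enat b"
proof -
  interpret weighted_arena G V0 V1 \<Omega> w b
    using assms(1) by (simp add: weighted_arena_def)
  have "Cost G V0 \<Omega> w v \<sigma> \<le> enat b" using assms(5) by simp
  then obtain \<sigma>' where "finite_state_of_size G V0 \<sigma>' (card memory)" "Cost G V0 \<Omega> w v \<sigma>' \<le> enat b"
    by (rule finite_state_strategy[OF assms(3,4)])
  then show ?thesis using assms(2) by (auto simp: card_memory)
qed

end
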